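(* Let $(X,T)$ be a rank-one subshift with unbounded spacer parameter and let $(Y,S)$ be a subshift. Suppose $(Y,S)$ is a topological factor of $(X,T)$. Then either $Y$ is trivial (that is, a singleton) or else $(X,T)$ is (topologically) isomorphic to $(Y,S)$.
   Context: A subshift is a topological dynamical system $(X,T)$ where, for some integer $b>1$, $X$ is a closed shift-invariant subset of $b^{\mathbb{Z}}=\{0,\dots,b-1\}^{\mathbb{Z}}$ (product topology) and $T$ is the shift map $(Tx)(k)=x(k+1)$. The alphabet sizes of $X$ and $Y$ may differ; $S$ denotes the shift map on $Y$. Rank-one subshift: Let $(q_n)_{n\ge 0}$ be a sequence of integers $>1$ (the cutting parameter) and $(a_{n,i})_{n\ge 0,\,1\le i<q_n}$ a doubly-indexed sequence of non-negative integers (the spacer parameter). Define binary words by $v_0=0$ and $$v_{n+1}=v_n1^{a_{n,1}}v_n1^{a_{n,2}}v_n\cdots v_n1^{a_{n,q_n-1}}v_n .$$ Each $v_n$ is an initial segment of $v_{n+1}$; let $V=\lim_{n\to\infty}v_n$ be the resulting (one-sided) infinite word. The rank-one subshift determined by these parameters is $(X_V,T)$ with $$X_V=\{x\in 2^{\mathbb{Z}} : \text{every finite subword of } x \text{ is a subword of } V\}$$ and $T$ the shift map. The spacer parameter is unbounded if $\sup_{n,i}a_{n,i}=\infty$. $(Y,S)$ is a topological factor of $(X,T)$ if there is a continuous surjection $\varphi:X\to Y$ with $\varphi(Tx)=S\varphi(x)$ for all $x\in X$. The systems are isomorphic if there is such a $\varphi$ that is a homeomorphism. *)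

theory Defs
  imports "HOL-Analysis.Analysis"
begin

text \<open>
  Bi-infinite sequences have type \<^typ>\<open>int \<Rightarrow> nat\<close>, with the library's product topology over
  the discrete space \<^typ>\<open>nat\<close>. The set of sequences with all entries below \<open>b\<close> is closed in this
  space and carries the usual product topology of \<open>{0,\<dots>,b-1}\<close>, so closedness and continuity
  have the same meaning in either space.
\<close>

definition shift :: "(int \<Rightarrow> 'a) \<Rightarrow> (int \<Rightarrow> 'a)" where
  "shift x = (\<lambda>k. x (k + 1))"

definition subshift :: "(int \<Rightarrow> nat) set \<Rightarrow> bool" where
  "subshift X \<longleftrightarrow>
     (\<exists>b>1. \<forall>x\<in>X. \<forall>k. x k < b) \<and> closed X \<and> shift ` X = X"

definition topological_factor ::
  "'a::topological_space set \<Rightarrow> ('a \<Rightarrow> 'a) \<Rightarrow> 'b::topological_space set \<Rightarrow> ('b \<Rightarrow> 'b) \<Rightarrow> bool" where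
  "topological_factor X T Y S \<longleftrightarrow>
     (\<exists>\<phi>. continuous_on X \<phi> \<and> \<phi> ` X = Y \<and> (\<forall>x\<in>X. \<phi> (T x) = S (\<phi> x)))"

definition topologically_isomorphic ::
  "'a::topological_space set \<Rightarrow> ('a \<Rightarrow> 'a) \<Rightarrow> 'b::topological_space set \<Rightarrow> ('b \<Rightarrow> 'b) \<Rightarrow> bool" where
  "topologically_isomorphic X T Y S \<longleftrightarrow>
     (\<exists>\<phi> \<psi>. homeomorphism X Y \<phi> \<psi> \<and> (\<forall>x\<in>X. \<phi> (T x) = S (\<phi> x)))"

text \<open>
  The cutting parameter is \<open>q\<close> and the spacer parameter is \<open>a\<close>; only the values \<open>a n i\<close> with
  \<open>1 \<le> i < q n\<close> are used.
\<close>

fun rank_one_block :: "(nat \<Rightarrow> nat) \<Rightarrow> (nat \<Rightarrow> nat \<Rightarrow> nat) \<Rightarrow> nat \<Rightarrow> nat list" where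
  "rank_one_block q a 0 = [0]"
| "rank_one_block q a (Suc n) =
     rank_one_block q a n @
     concat (map (\<lambda>i. replicate (a n i) 1 @ rank_one_block q a n) [1..<q n])"

text \<open>
  The limit word: its \<open>k\<close>-th letter is read off from the first block long enough to have one.
  By \<open>rank_one_word_nth\<close> below, every block is an initial segment of it.
\<close>

definition rank_one_word :: "(nat \<Rightarrow> nat) \<Rightarrow> (nat \<Rightarrow> nat \<Rightarrow> nat) \<Rightarrow> nat \<Rightarrow> nat" where
  "rank_one_word q a k =
     rank_one_block q a (LEAST n. k < length (rank_one_block q a n)) ! k"

definition subword_bi :: "'a list \<Rightarrow> (int \<Rightarrow> 'a) \<Rightarrow> bool" where
  "subword_bi w x \<longleftrightarrow> (\<exists>i. \<forall>k<length w. w ! k = x (i + int k))"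

definition subword_one :: "'a list \<Rightarrow> (nat \<Rightarrow> 'a) \<Rightarrow> bool" where
  "subword_one w V \<longleftrightarrow> (\<exists>i. \<forall>k<length w. w ! k = V (i + k))"

definition rank_one_subshift :: "(nat \<Rightarrow> nat) \<Rightarrow> (nat \<Rightarrow> nat \<Rightarrow> nat) \<Rightarrow> (int \<Rightarrow> nat) set" where
  "rank_one_subshift q a =
     {x. (\<forall>k. x k < 2) \<and> (\<forall>w. subword_bi w x \<longrightarrow> subword_one w (rank_one_word q a))}"

definition unbounded_spacer :: "(nat \<Rightarrow> nat) \<Rightarrow> (nat \<Rightarrow> nat \<Rightarrow> nat) \<Rightarrow> bool" where
  "unbounded_spacer q a \<longleftrightarrow> \<not> bdd_above {a n i | n i. 1 \<le> i \<and> i < q n}"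

lemma rank_one_block_initial:
  assumes "m \<le> n"
  shows "\<exists>w. rank_one_block q a n = rank_one_block q a m @ w"
  using assms by (induction n rule: dec_induct) auto

lemma rank_one_word_nth:
  assumes "k < length (rank_one_block q a n)"
  shows "rank_one_word q a k = rank_one_block q a n ! k"
proof -
  let ?m = "LEAST n. k < length (rank_one_block q a n)"
  have m: "k < length (rank_one_block q a ?m)"
    using assms by (rule LeastI)
  have "?m \<le> n"
    using assms by (rule Least_le)
  then obtain w where "rank_one_block q a n = rank_one_block q a ?m @ w"
    using rank_one_block_initial by blast
  with m show ?thesis
    by (simp add: rank_one_word_def nth_append)
qed

lemma rank_one_block_length:
  assumes "\<And>n. q n > 1"
  shows "n < length (rank_one_block q a n)"
proof (induction n)
  case (Suc n)
  have "[1..<q n] = 1 # [2..<q n]"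
    using assms[of n] by (simp add: upt_conv_Cons numeral_2_eq_2)
  with Suc show ?case
    by simp
qed simp

end

(* The factor map phi itself is injective unless it is constant. By compactness phi is a sliding
   block code. Let G be the image of the point 1 1 1 ... V (ones to the left of V), and c the letter
   that codes a long run of ones. If G is not constantly c, then the image of every large block v_n
   contains a letter other than c, so long runs of c in phi(x) can only come from long runs of ones
   in x, and the first letter other than c after such a run locates the end of the run in x. Hence
   two points x, y with the same image have long runs of ones ending at the same places, and to the
   right of such an end both are concatenations of the letter 1 and the block v_n. They cannot
   diverge there, since otherwise G would be periodic with a small period on a long interval that
   contains a longer run of c. Finally, unless x is 1 far to the left, it contains long runs of ones
   arbitrarily far to the left, so x = y everywhere. *)

theory Submission
  imports Defs
begin

subsection \<open>Sliding block codes\<close>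

lemma open_cylinder:
  fixes x :: "'a \<Rightarrow> 'b::discrete_topology"
  assumes "finite F"
  shows "open {y. \<forall>k\<in>F. y k = x k}"
proof -
  have "open ((\<lambda>y. y k) -` {x k})" for k
    using continuous_on_product_coordinates by (intro open_vimage) (auto simp: open_discrete)
  moreover have "{y. \<forall>k\<in>F. y k = x k} = (\<Inter>k\<in>F. (\<lambda>y. y k) -` {x k})"
    by auto
  ultimately show ?thesis using assms by auto
qed

lemma open_contains_cylinder:
  fixes U :: "('a \<Rightarrow> 'b::topological_space) set"
  assumes "open U" "x \<in> U"
  obtains F where "finite F" "\<And>y. (\<And>k. k \<in> F \<Longrightarrow> y k = x k) \<Longrightarrow> y \<in> U"
proof -
  obtain A where A: "x \<in> PiE UNIV A" "finite {i. A i \<noteq> UNIV}" "PiE UNIV A \<subseteq> U"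
    using product_topology_open_contains_basis[of "\<lambda>_. euclidean" UNIV U x] assms
    by (auto simp: open_fun_def)
  have "y \<in> U" if "\<And>k. A k \<noteq> UNIV \<Longrightarrow> y k = x k" for y
  proof -
    have "y k \<in> A k" for k using A(1) that[of k] by (cases "A k = UNIV") auto
    then show ?thesis using A(3) by auto
  qed
  then show thesis using that A(2) by auto
qed

text \<open>Near each point finitely many coordinates determine \<open>f\<close>; compactness leaves
  finitely many such cylinders, and the union of their coordinate sets serves all of
  \<open>X\<close>.\<close>

lemma continuous_on_locally_constant:
  fixes f :: "('a \<Rightarrow> 'b::discrete_topology) \<Rightarrow> 'c::discrete_topology"
  assumes "compact X" "continuous_on X f"
  obtains F where "finite F" "\<And>x y. \<lbrakk>x \<in> X; y \<in> X; \<And>k. k \<in> F \<Longrightarrow> x k = y k\<rbrakk> \<Longrightarrow> f x = f y"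
proof -
  have "\<exists>F. finite F \<and> (\<forall>y\<in>X. (\<forall>k\<in>F. y k = x k) \<longrightarrow> f y = f x)" if "x \<in> X" for x
  proof -
    obtain U where U: "open U" "U \<inter> X = f -` {f x} \<inter> X"
      using assms(2) open_discrete[of "{f x}"] unfolding continuous_on_open_invariant by blast
    then have "x \<in> U" using that by auto
    with U(1) obtain F where "finite F" "\<And>y. (\<And>k. k \<in> F \<Longrightarrow> y k = x k) \<Longrightarrow> y \<in> U"
      using open_contains_cylinder by blast
    then show ?thesis using U(2) by (intro exI[of _ F]) blast
  qed
  then obtain F where F: "\<And>x. x \<in> X \<Longrightarrow> finite (F x)"
      "\<And>x y. \<lbrakk>x \<in> X; y \<in> X; \<And>k. k \<in> F x \<Longrightarrow> y k = x k\<rbrakk> \<Longrightarrow> f y = f x"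
    by metis
  obtain C where C: "C \<subseteq> X" "finite C" "X \<subseteq> (\<Union>x\<in>C. {y. \<forall>k\<in>F x. y k = x k})"
  proof (rule compactE_image[OF assms(1)])
    show "open {y. \<forall>k\<in>F x. y k = x k}" if "x \<in> X" for x
      using F(1)[OF that] by (rule open_cylinder)
  qed auto
  show thesis
  proof (rule that)
    show "finite (\<Union>x\<in>C. F x)" using C F(1) by blast
    fix x y assume X: "x \<in> X" "y \<in> X" and eq: "\<And>k. k \<in> (\<Union>x\<in>C. F x) \<Longrightarrow> x k = y k"
    obtain z where z: "z \<in> C" "\<And>k. k \<in> F z \<Longrightarrow> x k = z k" using C(3) X(1) by blast
    then have "z \<in> X" using C(1) by blast
    have "f x = f z" using z(2) by (rule F(2)[OF \<open>z \<in> X\<close> X(1)])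
    moreover have "y k = z k" if "k \<in> F z" for k
    proof -
      have "x k = y k" by (rule eq) (use z(1) that in blast)
      then show ?thesis using z(2)[OF that] by simp
    qed
    then have "f y = f z" by (rule F(2)[OF \<open>z \<in> X\<close> X(2)])
    ultimately show "f x = f y" by simp
  qed
qed

text \<open>The library has no \<open>t2_space\<close> instance for functions into \<^typ>\<open>nat\<close>, so the codomain is embedded
  into real-valued functions, which form a metric space.\<close>

lemma homeomorphism_compact_nat:
  fixes f :: "'a::topological_space \<Rightarrow> 'i::countable \<Rightarrow> nat"
  assumes "compact S" "continuous_on S f" "inj_on f S"
  shows "\<exists>g. homeomorphism S (f ` S) f g"
proof -
  define e where "e = (\<lambda>(x::'i \<Rightarrow> nat) k. real (x k))"
  have e: "continuous_on T e" for T
    unfolding e_def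
    by (intro continuous_on_coordinatewise_then_product continuous_on_of_nat
        continuous_on_subset[OF continuous_on_product_coordinates]) auto
  have "inj e" by (auto simp: e_def inj_def fun_eq_iff)
  have "\<exists>h. homeomorphism S ((e \<circ> f) ` S) (e \<circ> f) h"
    using assms \<open>inj e\<close> e
    by (intro homeomorphism_compact continuous_on_compose comp_inj_on) (auto intro: inj_on_subset)
  then obtain h where h: "homeomorphism S ((e \<circ> f) ` S) (e \<circ> f) h" by blast
  have "continuous_on (f ` S) (h \<circ> e)"
    using h e by (intro continuous_on_compose) (auto simp: homeomorphism_def image_comp)
  then show ?thesis
    using h assms(2) by (intro exI[of _ "h \<circ> e"]) (auto simp: homeomorphism_def image_comp)
qed

text \<open>The Curtis--Hedlund--Lyndon theorem.\<close>

lemma sliding_block_code: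
  fixes X :: "(int \<Rightarrow> nat) set" and \<phi> :: "(int \<Rightarrow> nat) \<Rightarrow> (int \<Rightarrow> nat)"
  assumes "compact X" "continuous_on X \<phi>"
    and translate: "\<And>x i. x \<in> X \<Longrightarrow> (\<lambda>k. x (k + i)) \<in> X"
    and comm: "\<And>x. x \<in> X \<Longrightarrow> \<phi> (shift x) = shift (\<phi> x)"
  obtains r :: int where "0 \<le> r"
    "\<And>x y i j. \<lbrakk>x \<in> X; y \<in> X; \<And>k. \<bar>k\<bar> \<le> r \<Longrightarrow> x (i + k) = y (j + k)\<rbrakk> \<Longrightarrow> \<phi> x i = \<phi> y j"
proof -
  have "continuous_on X (\<lambda>x. \<phi> x 0)"
    using assms(2) by (rule continuous_on_product_then_coordinatewise)
  then obtain F where F: "finite F"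
      "\<And>x y. \<lbrakk>x \<in> X; y \<in> X; \<And>k. k \<in> F \<Longrightarrow> x k = y k\<rbrakk> \<Longrightarrow> \<phi> x 0 = \<phi> y 0"
    using continuous_on_locally_constant[OF assms(1)] by blast
  define r where "r = Max (insert 0 (abs ` F))"
  have r: "0 \<le> r" "\<And>k. k \<in> F \<Longrightarrow> \<bar>k\<bar> \<le> r"
    using F(1) by (auto simp: r_def)
  \<comment> \<open>Commutation with \<open>shift\<close> also covers negative translations: it is
    applied to the translate by \<open>i - 1\<close>.\<close>
  have trans: "\<phi> (\<lambda>k. x (k + i)) = (\<lambda>k. \<phi> x (k + i))" if x: "x \<in> X" for x i
  proof (induction i rule: int_induct[where k = 0])
    case base
    show ?case by simp
  next
    case (step1 i)
    have "\<phi> (shift (\<lambda>k. x (k + i))) = shift (\<phi> (\<lambda>k. x (k + i)))"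
      using comm translate x by blast
    then show ?case using step1 by (simp add: shift_def add_ac)
  next
    case (step2 i)
    have "\<phi> (shift (\<lambda>k. x (k + (i - 1)))) = shift (\<phi> (\<lambda>k. x (k + (i - 1))))"
      using comm translate x by blast
    then have *: "(\<lambda>k. \<phi> x (k + i)) = shift (\<phi> (\<lambda>k. x (k + (i - 1))))"
      using step2 by (simp add: shift_def)
    show ?case
    proof
      show "\<phi> (\<lambda>k. x (k + (i - 1))) k = \<phi> x (k + (i - 1))" for k
        using fun_cong[OF *, of "k - 1"] by (simp add: shift_def add_diff_eq diff_add_eq)
    qed
  qed
  show thesis
  proof (rule that[OF r(1)])
    fix x y i j assume X: "x \<in> X" "y \<in> X" and agree: "\<And>k. \<bar>k\<bar> \<le> r \<Longrightarrow> x (i + k) = y (j + k)"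
    have "\<phi> (\<lambda>k. x (k + i)) 0 = \<phi> (\<lambda>k. y (k + j)) 0"
      by (intro F(2) translate X) (use agree r(2) in \<open>simp add: add.commute\<close>)
    then show "\<phi> x i = \<phi> y j" using trans X by simp
  qed
qed

text \<open>Containing a given word is an open condition, so forbidding words gives a closed set,
  which is intersected with a product of finite sets.\<close>

lemma compact_rank_one_subshift: "compact (rank_one_subshift q a)"
proof -
  have "open {x :: int \<Rightarrow> nat. subword_bi w x}" for w
  proof -
    have "open (\<Inter>k<length w. (\<lambda>x::int \<Rightarrow> nat. x (i + int k)) -` {w ! k})" for i
      by (intro open_INT ballI open_vimage continuous_on_product_coordinates open_discrete) simp
    moreover have "{x :: int \<Rightarrow> nat. subword_bi w x}
        = (\<Union>i. \<Inter>k<length w. (\<lambda>x. x (i + int k)) -` {w ! k})"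
      by (auto simp: subword_bi_def eq_commute)
    ultimately show ?thesis by (simp add: open_UN)
  qed
  then have "closed {x. \<forall>w. subword_bi w x \<longrightarrow> subword_one w (rank_one_word q a)}"
    by (intro closed_Collect_all closed_Collect_imp closed_Collect_const)
  moreover have "compact (PiE UNIV (\<lambda>_. {..<2}) :: (int \<Rightarrow> nat) set)"
  proof -
    have "compactin (product_topology (\<lambda>_. euclidean) UNIV) (PiE UNIV (\<lambda>_. {..<2}) :: (int \<Rightarrow> nat) set)"
      unfolding compactin_PiE by (auto intro: finite_imp_compact)
    then show ?thesis by (simp add: euclidean_product_topology)
  qed
  moreover have "rank_one_subshift q a =
      {x. \<forall>w. subword_bi w x \<longrightarrow> subword_one w (rank_one_word q a)} \<inter> PiE UNIV (\<lambda>_. {..<2})"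
    by (auto simp: rank_one_subshift_def PiE_UNIV_domain)
  ultimately show ?thesis by (simp add: closed_Int_compact)
qed

subsection \<open>Rank-one words\<close>

declare One_nat_def [simp del]

text \<open>A spacer enters one letter at a time, so blocks may touch and a tiling may begin or end
  with ones.\<close>

inductive tiled :: "nat list \<Rightarrow> nat list \<Rightarrow> bool" for v :: "nat list" where
  tiled_Nil: "tiled v []"
| tiled_one: "tiled v w \<Longrightarrow> tiled v (1 # w)"
| tiled_block: "tiled v w \<Longrightarrow> tiled v (v @ w)"

lemma tiled_append: "tiled v w \<Longrightarrow> tiled v w' \<Longrightarrow> tiled v (w @ w')"
  by (induction rule: tiled.induct) (auto intro: tiled.intros)

lemma tiled_replicate: "tiled v (replicate s 1)"
  by (induction s) (auto intro: tiled.intros)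

lemma tiled_concat: "(\<And>w. w \<in> set ws \<Longrightarrow> tiled v w) \<Longrightarrow> tiled v (concat ws)"
  by (induction ws) (auto intro: tiled_append tiled_Nil)

lemma tiled_self: "tiled v v"
  using tiled_block[OF tiled_Nil, of v] by simp

text \<open>Spacers consist of ones, so a zero sits inside a tile. The tiled remainder
  \<open>u\<close> is kept for reading on to the right of that tile.\<close>

lemma tiled_zero:
  assumes "tiled v w" "k < length w" "w ! k = 0"
  shows "\<exists>d u. d \<le> k \<and> k < d + length v \<and> drop d w = v @ u \<and> tiled v u"
  using assms
proof (induction arbitrary: k rule: tiled.induct)
  case tiled_Nil
  then show ?case by simp
next
  case (tiled_one w)
  then obtain k' where k': "k = Suc k'" by (cases k) auto
  with tiled_one obtain d u where "d \<le> k'" "k' < d + length v" "drop d w = v @ u" "tiled v u"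
    by fastforce
  then show ?case using k' by (intro exI[of _ "Suc d"] exI[of _ u]) auto
next
  case (tiled_block w)
  show ?case
  proof (cases "k < length v")
    case True
    then show ?thesis using tiled_block by (intro exI[of _ 0] exI[of _ w]) auto
  next
    case False
    then have "k - length v < length w" "w ! (k - length v) = 0"
      using tiled_block.prems by (auto simp: nth_append)
    then obtain d u where "d \<le> k - length v" "k - length v < d + length v"
        "drop d w = v @ u" "tiled v u"
      using tiled_block.IH by blast
    then show ?thesis using False by (intro exI[of _ "length v + d"] exI[of _ u]) auto
  qed
qed

lemma tiled_block_block:
  assumes "n \<le> N"
  shows "tiled (rank_one_block q a n) (rank_one_block q a N)"
  using assms
proof (induction N rule: dec_induct)
  case base
  show ?case by (rule tiled_self)
next
  case (step N)
  show ?case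
    using step.IH by (auto intro!: tiled_append tiled_concat tiled_replicate)
qed

declare rank_one_block.simps(2) [simp del]

lemma rank_one_block_less2: "u \<in> set (rank_one_block q a n) \<Longrightarrow> u < 2"
  by (induction n) (auto simp: rank_one_block.simps(2) split: if_splits)

lemma rank_one_block_ne: "rank_one_block q a n \<noteq> []"
  by (induction n) (auto simp: rank_one_block.simps(2))

lemma rank_one_block_0: "rank_one_block q a n ! 0 = 0"
  using rank_one_block_initial[of 0 n q a] by auto

lemma rank_one_block_spacer:
  assumes "1 \<le> i" "i < q m"
  shows "\<exists>u w. rank_one_block q a (Suc m) = u @ replicate (a m i) 1 @ rank_one_block q a m @ w"
proof -
  have "[1..<q m] = [1..<i] @ i # [Suc i..<q m]"
    using assms upt_add_eq_append[of 1 i "q m - i"] by (simp add: upt_conv_Cons)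
  then show ?thesis
    by (simp add: rank_one_block.simps(2)) (metis append.assoc)
qed

section \<open>Long spacers and the points of the subshift\<close>

locale rank_one =
  fixes q :: "nat \<Rightarrow> nat" and a :: "nat \<Rightarrow> nat \<Rightarrow> nat"
  assumes q_gt_1: "\<And>n. q n > 1"
    and unbounded: "unbounded_spacer q a"
begin

abbreviation "v \<equiv> rank_one_block q a"
abbreviation "V \<equiv> rank_one_word q a"
abbreviation "X \<equiv> rank_one_subshift q a"

lemma length_block: "n < length (v n)"
  using q_gt_1 by (rule rank_one_block_length)

text \<open>Levels below \<open>n\<close> contribute finitely many spacers, so the unboundedness
  comes from the levels from \<open>n\<close> on.\<close>

lemma large_spacer: "\<exists>m i. n \<le> m \<and> 1 \<le> i \<and> i < q m \<and> K \<le> a m i"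
proof (rule ccontr)
  assume *: "\<not> ?thesis"
  let ?S = "\<Union>m<n. a m ` {1..<q m}"
  have "a m i \<le> Max (insert K ?S)" if "1 \<le> i" "i < q m" for m i
  proof (cases "n \<le> m")
    case True
    then have "a m i \<le> K" using * that by (meson linear)
    then show ?thesis by (meson Max_ge finite.insertI finite_UN finite_imageI finite_atLeastLessThan finite_lessThan insertI1 order_trans)
  next
    case False
    then have "a m i \<in> ?S" using that by (intro UN_I[of m] imageI) auto
    then show ?thesis by (intro Max_ge) auto
  qed
  then have "bdd_above {a n i | n i. 1 \<le> i \<and> i < q n}"
    by (intro bdd_aboveI[of _ "Max (insert K ?S)"]) auto
  then show False using unbounded by (simp add: unbounded_spacer_def)
qed

text \<open>A long spacer at a level at least \<open>n\<close> is followed by a block that begins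
  with \<open>v n\<close>; only its last \<open>K\<close> ones are used. The bound by
  \<open>length (v m)\<close> makes the pattern recur in each copy of \<open>v m\<close>.\<close>

lemma ones_before_block:
  "\<exists>m h. h + K + length (v n) \<le> length (v m) \<and> (\<forall>k<K. V (h + k) = 1)
     \<and> (\<forall>k<length (v n). V (h + K + k) = v n ! k)"
proof -
  obtain m i where mi: "n \<le> m" "1 \<le> i" "i < q m" "K \<le> a m i"
    using large_spacer by blast
  obtain u w where uw: "v (Suc m) = u @ replicate (a m i) 1 @ v m @ w"
    using rank_one_block_spacer mi by blast
  obtain w' where w': "v m = v n @ w'"
    using rank_one_block_initial mi by blast
  have split: "replicate (a m i) (1::nat) = replicate (a m i - K) 1 @ replicate K 1"
    using mi by (simp flip: replicate_add)
  define u' where "u' = u @ replicate (a m i - K) (1::nat)"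
  have eq: "v (Suc m) = u' @ replicate K 1 @ v n @ (w' @ w)"
    using uw w' split by (simp add: u'_def)
  then have len: "length u' + K + length (v n) \<le> length (v (Suc m))"
    by simp
  have V: "V k = v (Suc m) ! k" if "k < length u' + K + length (v n)" for k
    using rank_one_word_nth that len by (meson order_less_le_trans)
  show ?thesis
    using len
    by (intro exI[of _ "Suc m"] exI[of _ "length u'"]) (simp add: V eq nth_append)
qed

lemma far_ones: "\<exists>h\<ge>h0. \<forall>k<K. V (h + k) = 1"
proof -
  obtain h where h: "\<forall>k<h0 + K. V (h + k) = 1"
    using ones_before_block by blast
  show ?thesis
  proof (intro exI[of _ "h + h0"] conjI allI impI)
    show "V (h + h0 + k) = 1" if "k < K" for k
      using h[rule_format, of "h0 + k"] that by (simp add: add.assoc)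
  qed simp
qed

lemma word_less2: "V k < 2"
  using rank_one_word_nth[of k q a k] length_block[of k] rank_one_block_less2 nth_mem by metis

lemma in_X_iff:
  "x \<in> X \<longleftrightarrow> (\<forall>k. x k < 2) \<and> (\<forall>i n. \<exists>j. \<forall>k<n. x (i + int k) = V (j + k))"
  (is "_ \<longleftrightarrow> _ \<and> ?R")
proof -
  have "(\<forall>w. subword_bi w x \<longrightarrow> subword_one w V) \<longleftrightarrow> ?R"
  proof (intro iffI allI impI)
    fix i :: int and n :: nat
    assume "\<forall>w. subword_bi w x \<longrightarrow> subword_one w V"
    moreover have "subword_bi (map (\<lambda>k. x (i + int k)) [0..<n]) x"
      by (auto simp: subword_bi_def)
    ultimately have "subword_one (map (\<lambda>k. x (i + int k)) [0..<n]) V"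
      by blast
    then show "\<exists>j. \<forall>k<n. x (i + int k) = V (j + k)"
      by (auto simp: subword_one_def)
  next
    fix w
    assume R: ?R and "subword_bi w x"
    then show "subword_one w V"
      unfolding subword_bi_def subword_one_def by metis
  qed
  then show ?thesis by (simp add: rank_one_subshift_def)
qed

lemma X_binary: "x \<in> X \<Longrightarrow> x k = 0 \<or> x k = 1"
  unfolding in_X_iff by (metis less_2_cases One_nat_def)

text \<open>The window lies in an initial segment of \<open>V\<close>, hence in a long block; taking
  \<open>N \<ge> n\<close> makes that block tiled by \<open>v n\<close>.\<close>

lemma X_window:
  assumes "x \<in> X"
  shows "\<exists>N\<ge>n. \<exists>j. j + H \<le> length (v N) \<and> (\<forall>k<H. x (i + int k) = v N ! (j + k))"
proof -
  obtain j where j: "\<forall>k<H. x (i + int k) = V (j + k)"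
    using assms unfolding in_X_iff by metis
  let ?N = "n + j + H"
  have "j + H \<le> length (v ?N)" using length_block[of ?N] by simp
  then show ?thesis
    using j by (intro exI[of _ ?N] conjI exI[of _ j]) (auto intro!: rank_one_word_nth)
qed

lemma X_translate:
  assumes "x \<in> X"
  shows "(\<lambda>k. x (k + i)) \<in> X"
  unfolding in_X_iff
proof (intro conjI allI)
  show "x (k + i) < 2" for k using assms by (simp add: in_X_iff)
  fix i' :: int and n :: nat
  obtain j where "\<forall>k<n. x ((i' + i) + int k) = V (j + k)"
    using assms unfolding in_X_iff by blast
  then show "\<exists>j. \<forall>k<n. x (i' + int k + i) = V (j + k)"
    by (intro exI[of _ j]) (simp add: algebra_simps)
qed

definition ones_then_word :: "int \<Rightarrow> nat" where
  "ones_then_word k = (if k < 0 then 1 else V (nat k))"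

text \<open>A window starting at \<open>i\<close> has at most \<open>\<bar>i\<bar>\<close> letters
  left of 0, so a run of that many ones before a long block in \<open>V\<close> already shows the
  same letters.\<close>

lemma ones_then_word_in_X: "ones_then_word \<in> X"
  unfolding in_X_iff
proof (intro conjI allI)
  show "ones_then_word k < 2" for k
    by (simp add: ones_then_word_def word_less2)
  fix i :: int and n :: nat
  obtain m h where mh: "\<forall>k<nat \<bar>i\<bar>. V (h + k) = 1"
      "\<forall>k<length (v (nat \<bar>i\<bar> + n)). V (h + nat \<bar>i\<bar> + k) = v (nat \<bar>i\<bar> + n) ! k"
    using ones_before_block by blast
  have "ones_then_word (i + int k) = V (nat (int h + \<bar>i\<bar> + i) + k)" if "k < n" for k
  proof (cases "i + int k < 0")
    case True
    then have "nat (int h + \<bar>i\<bar> + i) + k = h + nat (\<bar>i\<bar> + i + int k)"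
      "nat (\<bar>i\<bar> + i + int k) < nat \<bar>i\<bar>"
      by auto
    then show ?thesis using mh True by (simp add: ones_then_word_def)
  next
    case False
    then have eq: "nat (int h + \<bar>i\<bar> + i) + k = h + nat \<bar>i\<bar> + nat (i + int k)"
      by auto
    have lt: "nat (i + int k) < length (v (nat \<bar>i\<bar> + n))"
      using length_block[of "nat \<bar>i\<bar> + n"] that by linarith
    then show ?thesis
      using mh False eq rank_one_word_nth[OF lt] by (simp add: ones_then_word_def)
  qed
  then show "\<exists>j. \<forall>k<n. ones_then_word (i + int k) = V (j + k)" by blast
qed

section \<open>Blocks and runs of ones inside points\<close>

definition occurs :: "nat list \<Rightarrow> (int \<Rightarrow> nat) \<Rightarrow> int \<Rightarrow> bool" where
  "occurs w x d \<longleftrightarrow> (\<forall>k<length w. x (d + int k) = w ! k)"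

lemma zero_in_block:
  assumes "x \<in> X" "x k = 0"
  shows "\<exists>d. k - int (length (v n)) < d \<and> d \<le> k \<and> occurs (v n) x d"
proof -
  let ?l = "length (v n)"
  \<comment> \<open>The tile around the zero starts less than \<open>?l\<close> places before it, so
    it fits into a window of length \<open>2 * ?l\<close> starting at \<open>k - ?l\<close>.\<close>
  obtain N j where Nj: "N \<ge> n" "j + 2 * ?l \<le> length (v N)"
      "\<forall>i<2 * ?l. x (k - int ?l + int i) = v N ! (j + i)"
    using X_window[OF assms(1), of n "2 * ?l" "k - int ?l"] by blast
  have l: "?l > 0" using rank_one_block_ne by simp
  have "v N ! (j + ?l) = 0"
    using Nj(3)[rule_format, of ?l] l assms(2) by simp
  moreover have "j + ?l < length (v N)" using Nj(2) l by linarith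
  ultimately obtain d u where d: "d \<le> j + ?l" "j + ?l < d + ?l" "drop d (v N) = v n @ u"
    using tiled_zero[OF tiled_block_block[OF Nj(1)]] by blast
  show ?thesis
  proof (intro exI[of _ "k - int ?l + int (d - j)"] conjI)
    show "occurs (v n) x (k - int ?l + int (d - j))"
      unfolding occurs_def
    proof (intro allI impI)
      fix i assume i: "i < ?l"
      have "v n ! i = drop d (v N) ! i" using d i by (simp add: nth_append)
      also have "\<dots> = v N ! (d + i)"
        using arg_cong[OF d(3), of length] i by (intro nth_drop) simp
      also have "d + i = j + (d - j + i)" using d by simp
      also have "v N ! \<dots> = x (k - int ?l + int (d - j + i))"
        using Nj(3)[rule_format, of "d - j + i"] d i by simp
      finally show "x (k - int ?l + int (d - j) + int i) = v n ! i"
        by (simp add: add.assoc)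
    qed
  qed (use d in auto)
qed

lemma occurs_0: "occurs (v n) x d \<Longrightarrow> x d = 0"
  using rank_one_block_ne[of q a n] rank_one_block_0[of q a n] unfolding occurs_def
  by (metis add.right_neutral length_greater_0_conv of_nat_0)

text \<open>Stated through finite prefixes, which avoids infinite tilings and compactness.\<close>

definition right_tiled :: "nat \<Rightarrow> (int \<Rightarrow> nat) \<Rightarrow> int \<Rightarrow> bool" where
  "right_tiled n x d \<longleftrightarrow>
     (\<forall>H. \<exists>w. tiled (v n) w \<and> H \<le> length w \<and> (\<forall>k<H. x (d + int k) = w ! k))"

lemma right_tiled_one:
  assumes "right_tiled n x d" "x d = 1"
  shows "right_tiled n x (d + 1)"
  unfolding right_tiled_def
proof
  fix H
  obtain w where w: "tiled (v n) w" "Suc H \<le> length w" "\<forall>k<Suc H. x (d + int k) = w ! k"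
    using assms(1) unfolding right_tiled_def by blast
  have "w ! 0 = 1" using w(3) assms(2) by auto
  with w(1) obtain w' where w': "w = 1 # w'" "tiled (v n) w'"
  proof cases
    case (tiled_block u)
    then show ?thesis using \<open>w ! 0 = 1\<close> rank_one_block_0[of q a n] rank_one_block_ne[of q a n]
      by (simp add: nth_append)
  qed (use w in auto)
  have "x (d + 1 + int k) = w' ! k" if "k < H" for k
    using w(3)[rule_format, of "Suc k"] that w' by (simp add: add.assoc)
  then show "\<exists>w. tiled (v n) w \<and> H \<le> length w \<and> (\<forall>k<H. x (d + 1 + int k) = w ! k)"
    using w w' by auto
qed

lemma right_tiled_zero:
  assumes "right_tiled n x d" "x d = 0"
  shows "occurs (v n) x d" "right_tiled n x (d + int (length (v n)))"
proof -
  let ?l = "length (v n)"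
  have *: "\<exists>w. tiled (v n) w \<and> H \<le> length w \<and> occurs (v n) x d
     \<and> (\<forall>k<H. x (d + int ?l + int k) = w ! k)" for H
  proof -
    obtain w where w: "tiled (v n) w" "Suc (?l + H) \<le> length w"
        "\<forall>k<Suc (?l + H). x (d + int k) = w ! k"
      using assms(1) unfolding right_tiled_def by blast
    have "w ! 0 = 0" using w(3) assms(2) by auto
    with w(1) obtain w' where w': "w = v n @ w'" "tiled (v n) w'"
      by cases (use w in auto)
    have "x (d + int ?l + int k) = w' ! k" if "k < H" for k
      using w(3)[rule_format, of "?l + k"] that w' by (simp add: add.assoc)
    moreover have "occurs (v n) x d"
      using w(3) w' by (auto simp: occurs_def nth_append)
    ultimately show ?thesis using w w' by auto
  qed
  show "occurs (v n) x d" using * by blast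
  show "right_tiled n x (d + int ?l)" using * unfolding right_tiled_def by blast
qed

definition run_before :: "(int \<Rightarrow> nat) \<Rightarrow> int \<Rightarrow> int \<Rightarrow> bool" where
  "run_before x e L \<longleftrightarrow> x e = 0 \<and> (\<forall>k. e - L \<le> k \<and> k < e \<longrightarrow> x k = 1)"

lemma run_before_mono: "run_before x e L \<Longrightarrow> M \<le> L \<Longrightarrow> run_before x e M"
  by (auto simp: run_before_def)

text \<open>The tile covering the zero at \<open>e\<close> starts less than
  \<open>length (v n)\<close> places before \<open>e\<close> or at \<open>e\<close> itself. Blocks
  begin with 0 and those earlier places hold ones, so it starts at \<open>e\<close>.\<close>

lemma right_tiled_after_ones:
  assumes "x \<in> X" and run: "run_before x e (int (length (v n)))"
  shows "right_tiled n x e"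
  unfolding right_tiled_def
proof
  fix H
  let ?l = "length (v n)"
  obtain N j where Nj: "N \<ge> n" "j + (?l + Suc H) \<le> length (v N)"
      "\<forall>i<?l + Suc H. x (e - int ?l + int i) = v N ! (j + i)"
    using X_window[OF assms(1), of n "?l + Suc H" "e - int ?l"] by blast
  have "v N ! (j + ?l) = 0"
    using Nj(3)[rule_format, of ?l] run by (simp add: run_before_def)
  moreover have "j + ?l < length (v N)" using Nj(2) by linarith
  ultimately obtain d u where d: "d \<le> j + ?l" "j + ?l < d + ?l" "drop d (v N) = v n @ u" "tiled (v n) u"
    using tiled_zero[OF tiled_block_block[OF Nj(1)]] by blast
  have "d = j + ?l"
  proof (rule ccontr)
    assume ne: "d \<noteq> j + ?l"
    have "v N ! d = drop d (v N) ! 0" using d(1) Nj(2) by (subst nth_drop) auto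
    then have "v N ! d = 0"
      using d rank_one_block_0[of q a n] rank_one_block_ne[of q a n] by (simp add: nth_append)
    moreover have "v N ! d = x (e - int ?l + int (d - j))"
      using Nj(3)[rule_format, of "d - j"] d ne by simp
    moreover have "x (e - int ?l + int (d - j)) = 1"
      using d ne run unfolding run_before_def by auto
    ultimately show False by simp
  qed
  have "tiled (v n) (drop d (v N))" using d by (simp add: tiled_block)
  moreover have "H \<le> length (drop d (v N))" using \<open>d = _\<close> Nj by simp
  moreover have "x (e + int k) = drop d (v N) ! k" if "k < H" for k
    using Nj(3)[rule_format, of "?l + k"] that \<open>d = _\<close> Nj(2) by (simp add: add.assoc)
  ultimately show "\<exists>w. tiled (v n) w \<and> H \<le> length w \<and> (\<forall>k<H. x (e + int k) = w ! k)"
    by blast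
qed

text \<open>Some block \<open>v m\<close> contains the desired run followed by a zero, and each zero
  of \<open>x\<close> lies in a copy of \<open>v m\<close>; zeros far to the left supply such copies
  there.\<close>

lemma long_runs_left:
  assumes "x \<in> X" and zeros: "\<And>k. \<exists>z\<le>k. x z = 0"
  shows "\<exists>e\<le>k0. run_before x e L"
proof -
  define K where "K = nat L"
  obtain m h where mh: "h + K + length (v 0) \<le> length (v m)" "\<forall>k<K. V (h + k) = 1"
      "\<forall>k<length (v 0). V (h + K + k) = v 0 ! k"
    using ones_before_block[of K 0] by blast
  obtain z where z: "z \<le> k0 - int (length (v m))" "x z = 0" using zeros by blast
  obtain d where d: "d \<le> z" "occurs (v m) x d" using zero_in_block[OF assms(1) z(2)] by blast
  have x: "x (d + int k) = V k" if "k < length (v m)" for k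
    using d(2) that rank_one_word_nth[OF that] by (simp add: occurs_def)
  show ?thesis
    unfolding run_before_def
  proof (intro exI[of _ "d + int (h + K)"] conjI allI impI)
    show "d + int (h + K) \<le> k0" using d z mh(1) by linarith
    show "x (d + int (h + K)) = 0" using x[of "h + K"] mh by simp
    fix k assume k: "d + int (h + K) - L \<le> k \<and> k < d + int (h + K)"
    define j where "j = nat (k - d - int h)"
    have "k = d + int (h + j)" "j < K" using k by (auto simp: j_def K_def split: if_splits)
    then show "x k = 1" using x[of "h + j"] mh by simp
  qed
qed

end

subsection \<open>Injectivity of nontrivial codes\<close>

locale rank_one_code = rank_one +
  fixes \<phi> :: "(int \<Rightarrow> nat) \<Rightarrow> (int \<Rightarrow> nat)" and r :: int
  assumes r_nonneg: "0 \<le> r"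
    and code: "\<And>x y i j. \<lbrakk>x \<in> X; y \<in> X; \<And>k. \<bar>k\<bar> \<le> r \<Longrightarrow> x (i + k) = y (j + k)\<rbrakk>
                 \<Longrightarrow> \<phi> x i = \<phi> y j"
begin

definition "G = \<phi> ones_then_word"

text \<open>At \<open>- r - 1\<close> the coding window ends at \<open>-1\<close>, so it contains
  only ones.\<close>

definition "c = G (- r - 1)"

lemma code_ones:
  assumes "x \<in> X" "\<And>k. i - r \<le> k \<Longrightarrow> k \<le> i + r \<Longrightarrow> x k = 1"
  shows "\<phi> x i = c"
  unfolding c_def G_def
  by (rule code) (use assms ones_then_word_in_X in \<open>auto simp: ones_then_word_def abs_le_iff\<close>)

lemma G_left: "k < - r \<Longrightarrow> G k = c"
  unfolding G_def by (rule code_ones[OF ones_then_word_in_X]) (auto simp: ones_then_word_def)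

text \<open>Near \<open>d\<close> the point looks like \<open>ones_then_word\<close> near 0, with
  \<open>h\<close> ones before the block; the bounds on \<open>k\<close> keep the coding window
  within these letters.\<close>

lemma code_block:
  assumes "x \<in> X" "occurs (v n) x d" "\<And>k. d - h \<le> k \<Longrightarrow> k < d \<Longrightarrow> x k = 1"
    and "r - h \<le> k" "k + r < int (length (v n))"
  shows "\<phi> x (d + k) = G k"
  unfolding G_def
proof (rule code[OF assms(1) ones_then_word_in_X])
  fix i assume i: "\<bar>i\<bar> \<le> r"
  show "x (d + k + i) = ones_then_word (k + i)"
  proof (cases "k + i < 0")
    case True
    then show ?thesis using i assms by (auto simp: ones_then_word_def)
  next
    case False
    then have *: "nat (k + i) < length (v n)" using i assms(5) by linarith
    have "x (d + int (nat (k + i))) = v n ! nat (k + i)"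
      using assms(2) * unfolding occurs_def by blast
    then show ?thesis
      using False rank_one_word_nth[OF *] by (simp add: ones_then_word_def add.assoc)
  qed
qed

text \<open>The coding window around \<open>i\<close> recurs inside \<open>V\<close>, hence right of
  0 in \<open>ones_then_word\<close>. In particular a constant \<open>G\<close> makes every image
  constant.\<close>

lemma code_recurs:
  assumes "x \<in> X"
  shows "\<exists>m\<ge>r. \<phi> x i = G m"
proof -
  obtain j where j: "\<forall>k<nat (2 * r + 1). x (i - r + int k) = V (j + k)"
    using assms unfolding in_X_iff by blast
  have "\<phi> x i = G (int j + r)"
    unfolding G_def
  proof (rule code[OF assms ones_then_word_in_X])
    fix k assume k: "\<bar>k\<bar> \<le> r"
    then have "nat (k + r) < nat (2 * r + 1)" by auto
    with j have "x (i - r + int (nat (k + r))) = V (j + nat (k + r))" by blast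
    moreover have "nat (int j + r + k) = j + nat (k + r)" "0 \<le> int j + r + k" "0 \<le> k + r"
      using k by auto
    ultimately show "x (i + k) = ones_then_word (int j + r + k)"
      using k by (simp add: ones_then_word_def)
  qed
  then show ?thesis by (intro exI[of _ "int j + r"]) auto
qed

end

section \<open>Recovering runs of ones from the image\<close>

locale rank_one_nontrivial_code = rank_one_code +
  assumes nontrivial: "\<exists>k. G k \<noteq> c"
begin

lemma first_nontrivial: "\<exists>p\<ge>-r. G p \<noteq> c \<and> (\<forall>k<p. G k = c)"
proof -
  obtain k where k: "G k \<noteq> c" using nontrivial by blast
  then have "- r \<le> k" using G_left not_less by blast
  then have ex: "G (- r + int (nat (k + r))) \<noteq> c" using k by simp
  define m where "m = (LEAST m. G (- r + int m) \<noteq> c)"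
  have m: "G (- r + int m) \<noteq> c" unfolding m_def by (rule LeastI) (rule ex)
  have less: "G (- r + int j) = c" if "j < m" for j
    using not_less_Least[of j "\<lambda>m. G (- r + int m) \<noteq> c"] that by (auto simp: m_def)
  have "G j = c" if "j < - r + int m" for j
  proof (cases "j < - r")
    case False
    then show ?thesis using less[of "nat (j + r)"] that by simp
  qed (rule G_left)
  then show ?thesis using m by (intro exI[of _ "- r + int m"]) auto
qed

text \<open>Applying \<open>code_recurs\<close> to \<open>ones_then_word\<close> itself moves the
  letter to a position whose coding window lies inside \<open>V\<close>, so it appears in the image
  of each long block.\<close>

lemma late_nontrivial: "\<exists>p\<ge>r. G p \<noteq> c"
  using nontrivial code_recurs[OF ones_then_word_in_X] unfolding G_def by metis

text \<open>A zero of \<open>y\<close> would lie in a block whose image contains \<open>G p\<close>,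
  whereas \<open>\<phi> x\<close> is constantly \<open>c\<close>.\<close>

lemma eq_ones:
  assumes "x \<in> X" "y \<in> X" "\<phi> x = \<phi> y" "\<And>k. x k = 1"
  shows "y k = 1"
proof (rule ccontr)
  assume "y k \<noteq> 1"
  then have y: "y k = 0" using X_binary[OF assms(2)] by blast
  obtain p where p: "p \<ge> r" "G p \<noteq> c" using late_nontrivial by blast
  obtain d where d: "occurs (v (nat (p + r))) y d"
    using zero_in_block[OF assms(2) y] by blast
  have "\<phi> y (d + p) = G p"
    using length_block[of "nat (p + r)"] p
    by (intro code_block[OF assms(2) d, of 0]) auto
  moreover have "\<phi> x (d + p) = c" using assms by (intro code_ones) auto
  ultimately show False using p assms by simp
qed

text \<open>A long run of ones shows in the image as a run of \<open>c\<close> whose first other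
  letter has offset \<open>p\<close> from the zero ending the run. As the image is shared, the ends
  of the runs agree.\<close>

lemma long_run_transfer:
  "\<exists>L. \<forall>x\<in>X. \<forall>y\<in>X. \<forall>e. \<phi> x = \<phi> y \<and> run_before x e L \<longrightarrow> run_before y e M"
proof -
  obtain p where p: "p \<ge> - r" "G p \<noteq> c" "\<And>k. k < p \<Longrightarrow> G k = c" using first_nontrivial by blast
  obtain p1 where p1: "p1 \<ge> r" "G p1 \<noteq> c" using late_nontrivial by blast
  \<comment> \<open>The block \<open>v n\<close> and the ones before it decide \<open>G\<close> at
    \<open>p\<close> and at \<open>p1\<close>, coding windows included.\<close>
  define n where "n = nat (p1 + r + \<bar>p\<bar>)"
  define l where "l = int (length (v n))"
  have l: "p1 + r + \<bar>p\<bar> < l" using length_block[of n] p p1 r_nonneg by (simp add: n_def l_def)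
  define L where "L = \<bar>M\<bar> + 4 * r + 5 * l"
  \<comment> \<open>A block of \<open>y\<close> covering \<open>e + j\<close> with
    \<open>j \<ge> lo\<close> starts right of \<open>e + r - L\<close>, where \<open>xG\<close>
    below describes the image.\<close>
  define lo where "lo = - L + r + l"
  show ?thesis
  proof (intro exI[of _ L] ballI allI impI)
    fix x y e assume X: "x \<in> X" "y \<in> X"
    assume "\<phi> x = \<phi> y \<and> run_before x e L"
    then have *: "\<phi> x = \<phi> y" "x e = 0"
      and ones: "\<And>k. e - L \<le> k \<Longrightarrow> k < e \<Longrightarrow> x k = 1"
      by (auto simp: run_before_def)
    obtain d where d: "e - l < d" "d \<le> e" "occurs (v n) x d"
      using zero_in_block[OF X(1), of e n] * by (auto simp: l_def)
    have "d = e"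
      using ones[of d] occurs_0[OF d(3)] d l L_def r_nonneg p1 by fastforce
    then have xG: "\<phi> y (e + k) = G k" if "r - L \<le> k" "k + r < l" for k
      using code_block[OF X(1) d(3), of L k] ones that * by (simp add: l_def)
    \<comment> \<open>A zero of \<open>y\<close> here would lie in a block whose image has a letter other than \<open>c\<close>,
      but \<open>\<phi> y = \<phi> x\<close> is constantly \<open>c\<close> before position \<open>e + p\<close>.\<close>
    have y_far: "y (e + j) = 1" if j: "lo \<le> j" "j \<le> p - l" for j
    proof (rule ccontr)
      assume "y (e + j) \<noteq> 1"
      then have "y (e + j) = 0" using X_binary[OF X(2)] by blast
      then obtain d where d: "e + j - l < d" "d \<le> e + j" "occurs (v n) y d"
        using zero_in_block[OF X(2)] unfolding l_def by blast
      have "\<phi> y (d + p1) = G p1"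
        using l p1 by (intro code_block[OF X(2) d(3), of 0]) (auto simp: l_def)
      moreover have "\<phi> y (e + (d - e + p1)) = G (d - e + p1)"
        using d j l p p1 r_nonneg by (intro xG) (auto simp: lo_def)
      moreover have "G (d - e + p1) = c" using d j l r_nonneg by (intro p(3)) linarith
      ultimately show False using p1 by simp
    qed
    have lo: "lo \<le> p - l - l - r" using p l p1 r_nonneg by (simp add: lo_def L_def)
    \<comment> \<open>Otherwise ones fill the coding window around \<open>e + p\<close>, and the
      letter there is \<open>c\<close>, not \<open>G p\<close>.\<close>
    have ex: "\<exists>j. lo \<le> j \<and> j \<le> p + r \<and> y (e + j) = 0"
    proof (rule ccontr)
      assume none: "\<not> ?thesis"
      have "y k = 1" if "e + p - r \<le> k" "k \<le> e + p + r" for k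
      proof -
        have "lo \<le> k - e" "k - e \<le> p + r" using that lo l p1 p r_nonneg by linarith+
        then have "y (e + (k - e)) \<noteq> 0" using none[unfolded not_ex, THEN spec, of "k - e"] by simp
        then show ?thesis using X_binary[OF X(2), of k] by simp
      qed
      then have "\<phi> y (e + p) = c" by (intro code_ones[OF X(2)]) auto
      moreover have "\<phi> y (e + p) = G p" using p l lo r_nonneg p1 by (intro xG) (auto simp: lo_def L_def)
      ultimately show False using p by simp
    qed
    \<comment> \<open>\<open>lo + m\<close>, called \<open>j\<close> below, is the offset from
      \<open>e\<close> of the first zero of \<open>y\<close> from \<open>e + lo\<close> on; the aim
      is \<open>j = 0\<close>.\<close>
    define m where "m = (LEAST m. y (e + lo + int m) = 0)"
    obtain j0 where j0: "lo \<le> j0" "j0 \<le> p + r" "y (e + j0) = 0" using ex by blast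
    then have j0': "y (e + lo + int (nat (j0 - lo))) = 0" by simp
    define j where "j = lo + int m"
    have yj: "y (e + j) = 0"
      using LeastI[of "\<lambda>m. y (e + lo + int m) = 0", OF j0'] by (simp add: m_def j_def add.assoc)
    have "m \<le> nat (j0 - lo)"
      unfolding m_def using j0' by (rule Least_le)
    then have j_le: "j \<le> p + r" using j0 by (simp add: j_def)
    have y_ones: "y k = 1" if k: "e + lo \<le> k" "k < e + j" for k
    proof -
      have "nat (k - e - lo) < m" using k by (simp add: j_def)
      then have "y (e + lo + int (nat (k - e - lo))) \<noteq> 0" unfolding m_def by (rule not_less_Least)
      then show ?thesis using k X_binary[OF X(2), of k] by simp
    qed
    have j_gt: "p - l < j"
      using y_far[of j] yj by (force simp: j_def)
    obtain d where d: "e + j - l < d" "d \<le> e + j" "occurs (v n) y d"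
      using zero_in_block[OF X(2) yj] unfolding l_def by blast
    have "d = e + j"
      using y_ones[of d] occurs_0[OF d(3)] d lo j_gt r_nonneg p by force
    then have yG: "\<phi> y (e + (j + k)) = G k" if "lo - j + r \<le> k" "k + r < l" for k
      using code_block[OF X(2) d(3), of "j - lo" k] y_ones that by (auto simp: l_def algebra_simps)
    \<comment> \<open>The first letter other than \<open>c\<close> of \<open>\<phi> y\<close> is at \<open>e + j + p\<close> and at \<open>e + p\<close>.\<close>
    have "j = 0"
    proof (rule ccontr)
      assume "j \<noteq> 0"
      then consider "j > 0" | "j < 0" by linarith
      then show False
      proof cases
        case 1
        have "\<phi> y (e + (j + (p - j))) = G (p - j)"
          using 1 l j_gt j_le lo p p1 r_nonneg by (intro yG) (auto simp: lo_def L_def)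
        moreover have "G (p - j) = c" using 1 p by simp
        moreover have "\<phi> y (e + p) = G p"
          using l lo r_nonneg p p1 by (intro xG) (auto simp: lo_def L_def)
        ultimately show False using p by simp
      next
        case 2
        have "\<phi> y (e + (j + p)) = G p"
          using 2 l j_gt lo p p1 r_nonneg by (intro yG) (auto simp: lo_def L_def)
        moreover have "\<phi> y (e + (j + p)) = G (j + p)"
          using 2 l j_gt lo p p1 r_nonneg by (intro xG) (auto simp: lo_def L_def)
        moreover have "G (j + p) = c" using 2 p by simp
        ultimately show False using p by simp
      qed
    qed
    moreover have "lo \<le> - M" using l p1 r_nonneg by (simp add: lo_def L_def)
    ultimately show "run_before y e M"
      using yj y_ones by (auto simp: run_before_def)
  qed
qed

text \<open>If \<open>y d = 1\<close>, then the next block of \<open>y\<close> starts \<open>t \<le> p + r\<close> places after that of \<open>x\<close>, so \<open>G\<close> has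
  period \<open>t\<close> between \<open>p\<close> and a run of \<open>c\<close> longer than \<open>t\<close>, contradicting \<open>G p \<noteq> c\<close>.\<close>

lemma right_tiled_no_split:
  "\<exists>n0. \<forall>n\<ge>n0. \<forall>x\<in>X. \<forall>y\<in>X. \<forall>d. \<phi> x = \<phi> y \<and> right_tiled n x d \<and> right_tiled n y d \<and> x d = 0
     \<longrightarrow> y d = 0"
proof -
  obtain p where p: "p \<ge> r" "G p \<noteq> c" using late_nontrivial by blast
  \<comment> \<open>These ones make \<open>G\<close> equal to \<open>c\<close> on
    \<open>p + r + 1\<close> consecutive places to the right of \<open>p\<close>, so steps of length
    \<open>t \<le> p + r\<close> cannot jump over them.\<close>
  obtain h where h: "h \<ge> nat (p + r)" "\<And>k. k < nat (p + 3 * r + 1) \<Longrightarrow> V (h + k) = 1"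
    using far_ones by blast
  have G_run: "G k = c" if k: "int h + r \<le> k" "k \<le> int h + p + 2 * r" for k
    unfolding G_def
  proof (rule code_ones[OF ones_then_word_in_X])
    fix i assume i: "k - r \<le> i" "i \<le> k + r"
    then have "V (h + nat (i - int h)) = 1" using k by (intro h(2)) auto
    moreover have "h + nat (i - int h) = nat i" "0 \<le> i" using i k by auto
    ultimately show "ones_then_word i = 1" by (simp add: ones_then_word_def)
  qed
  define n0 where "n0 = nat (int h + p + 4 * r)"
  show ?thesis
  proof (intro exI[of _ n0] ballI allI impI)
    fix n x y d assume "n \<ge> n0" and X: "x \<in> X" "y \<in> X"
    assume *: "\<phi> x = \<phi> y \<and> right_tiled n x d \<and> right_tiled n y d \<and> x d = 0"
    define l where "l = int (length (v n))"
    have l: "int h + p + 4 * r < l"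
      using \<open>n \<ge> n0\<close> length_block[of n] p r_nonneg by (simp add: n0_def l_def)
    have xG: "\<phi> y (d + k) = G k" if "r \<le> k" "k + r < l" for k
      using code_block[OF X(1) right_tiled_zero(1)[of n x d], of 0 k] * that by (auto simp: l_def)
    show "y d = 0"
    proof (rule ccontr)
      assume "y d \<noteq> 0"
      have "\<exists>k. d \<le> k \<and> k \<le> d + p + r \<and> y k = 0"
      proof (rule ccontr)
        assume "\<not> ?thesis"
        then have "y k = 1" if "d \<le> k" "k \<le> d + p + r" for k
          using that X_binary[OF X(2), of k] by blast
        then have "\<phi> y (d + p) = c" using p by (intro code_ones[OF X(2)]) auto
        then show False using xG[of p] p l r_nonneg by simp
      qed
      then obtain k0 where k0: "d \<le> k0" "k0 \<le> d + p + r" "y k0 = 0" by blast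
      define t where "t = (LEAST t. y (d + int t) = 0)"
      have k0': "y (d + int (nat (k0 - d))) = 0" using k0 by simp
      have t: "y (d + int t) = 0" unfolding t_def using k0' by (rule LeastI)
      have "t \<le> nat (k0 - d)" unfolding t_def using k0' by (rule Least_le)
      then have t_le: "int t \<le> p + r" using k0 by linarith
      have t_pos: "0 < t" using t \<open>y d \<noteq> 0\<close> by (cases t) auto
      \<comment> \<open>Before \<open>d + t\<close> the point \<open>y\<close> has only ones, and
        each moves the tile boundary one place right.\<close>
      have "right_tiled n y (d + int s)" if "s \<le> t" for s
        using that
      proof (induction s)
        case 0
        then show ?case using * by simp
      next
        case (Suc s)
        have "y (d + int s) \<noteq> 0"
          using Suc.prems not_less_Least[of s "\<lambda>t. y (d + int t) = 0"] by (simp add: t_def)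
        then have "y (d + int s) = 1" using X_binary[OF X(2), of "d + int s"] by simp
        with Suc show ?case using right_tiled_one[of n y "d + int s"] by (simp add: algebra_simps)
      qed
      then have "occurs (v n) y (d + int t)" using t by (intro right_tiled_zero(1)) auto
      then have yG: "\<phi> y (d + int t + k) = G k" if "r \<le> k" "k + r < l" for k
        using code_block[OF X(2), of n "d + int t" 0 k] that by (auto simp: l_def)
      have period: "G (k + int t) = G k" if "r \<le> k" "k + int t + r < l" for k
        using xG[of "k + int t"] yG[of k] that by (simp add: algebra_simps)
      have multiple: "G (p + int (m * t)) = G p" if "p + int (m * t) + r < l" for m
        using that
      proof (induction m)
        case (Suc m)
        have "G (p + int (m * t) + int t) = G (p + int (m * t))"
          using Suc.prems p by (intro period) (auto simp: algebra_simps add_increasing2)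
        with Suc show ?case by (simp add: algebra_simps)
      qed simp
      \<comment> \<open>\<open>m * t\<close> is the least multiple of \<open>t\<close> exceeding
        \<open>s\<close>, so \<open>p + m * t\<close> passes \<open>h + r\<close> by at most
        \<open>t\<close> and lands in the run of \<open>c\<close>.\<close>
      define s where "s = nat (int h + r - p)"
      define m where "m = Suc (s div t)"
      have "s < m * t" "m * t \<le> s + t"
        using t_pos dividend_less_div_times[of t s] by (auto simp: m_def div_times_less_eq_dividend)
      moreover have "int s = int h + r - p" using h(1) r_nonneg by (simp add: s_def)
      ultimately have m: "int h + r \<le> p + int (m * t)" "p + int (m * t) \<le> int h + p + 2 * r"
        using t_le by linarith+
      then have "G (p + int (m * t)) = c" by (rule G_run)
      moreover have "G (p + int (m * t)) = G p" using m l r_nonneg by (intro multiple) linarith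
      ultimately show False using p by simp
    qed
  qed
qed

section \<open>Points with the same image coincide\<close>

text \<open>At a common tile boundary the next letters agree, by \<open>right_tiled_no_split\<close>
  in both directions; then both points pass the same letter 1 or the same block \<open>v n\<close>
  to the next common boundary.\<close>

lemma right_tiled_eq:
  "\<exists>n. \<forall>x\<in>X. \<forall>y\<in>X. \<forall>d k. \<phi> x = \<phi> y \<and> right_tiled n x d \<and> right_tiled n y d
     \<and> d \<le> k \<longrightarrow> x k = y k"
proof -
  obtain n where n: "\<And>x y d. \<lbrakk>x \<in> X; y \<in> X; \<phi> x = \<phi> y; right_tiled n x d; right_tiled n y d; x d = 0\<rbrakk>
      \<Longrightarrow> y d = 0"
    using right_tiled_no_split by blast
  have "x k = y k"
    if X: "x \<in> X" "y \<in> X" "\<phi> x = \<phi> y" and "right_tiled n x d" "right_tiled n y d" "d \<le> k"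
    for x y d k
    using that(4-)
  proof (induction "nat (k - d)" arbitrary: d rule: less_induct)
    case less
    have eq: "x d = y d"
      using n[OF X less.prems(1,2)] n[OF X(2,1) X(3)[symmetric] less.prems(2,1)]
        X_binary[OF X(1), of d] X_binary[OF X(2), of d] by auto
    show ?case
    proof (cases "k = d")
      case False
      show ?thesis
      proof (cases "x d = 0")
        case True
        let ?l = "int (length (v n))"
        have l: "?l > 0" using rank_one_block_ne by simp
        have o: "occurs (v n) x d" "occurs (v n) y d"
          using right_tiled_zero(1) less.prems True eq by auto
        show ?thesis
        proof (cases "k < d + ?l")
          case True
          then have "nat (k - d) < length (v n)" using less.prems by linarith
          then have "x (d + int (nat (k - d))) = y (d + int (nat (k - d)))"
            using o unfolding occurs_def by metis
          then show ?thesis using less.prems by simp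
        next
          case False
          then have le: "d + ?l \<le> k" and lt: "nat (k - (d + ?l)) < nat (k - d)"
            using l by linarith+
          have "y d = 0" using \<open>x d = 0\<close> eq by simp
          then show ?thesis
            using less.hyps[OF lt _ _ le] right_tiled_zero(2) less.prems(1,2) \<open>x d = 0\<close> by blast
        qed
      next
        case nonzero: False
        then have "x d = 1" using X_binary[OF X(1), of d] by simp
        then show ?thesis
          using eq less.prems False by (intro less.hyps[of "d + 1"] right_tiled_one) auto
      qed
    qed (use eq in simp)
  qed
  then show ?thesis by blast
qed

lemma code_inj: "inj_on \<phi> X"
proof (rule inj_onI, rule ext)
  fix x y k assume X: "x \<in> X" "y \<in> X" and eq: "\<phi> x = \<phi> y"
  show "x k = y k"
  proof (cases "\<exists>k. x k = 0")
    case False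
    then have "x k = 1" for k using X_binary[OF X(1), of k] by blast
    then show ?thesis using eq_ones[OF X eq] by simp
  next
    case True
    obtain n where n: "\<And>d k. \<lbrakk>right_tiled n x d; right_tiled n y d; d \<le> k\<rbrakk> \<Longrightarrow> x k = y k"
      using right_tiled_eq X eq by blast
    define l where "l = int (length (v n))"
    obtain L where L: "\<And>e. run_before x e L \<Longrightarrow> run_before y e l"
      using long_run_transfer[of l] X eq by blast
    \<comment> \<open>Length \<open>L\<close> carries the run over to \<open>y\<close> with length
      \<open>l\<close>; length \<open>l\<close> makes \<open>x\<close> itself tiled from
      \<open>e\<close> on.\<close>
    have right: "x k = y k" if e: "run_before x e (max L l)" and "e \<le> k" for e
    proof (rule n[OF _ _ \<open>e \<le> k\<close>])
      show "right_tiled n x e"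
        using X(1) run_before_mono[OF e, of l] by (simp add: right_tiled_after_ones l_def)
      show "right_tiled n y e"
        using X(2) L run_before_mono[OF e, of L] by (simp add: right_tiled_after_ones l_def)
    qed
    show ?thesis
    proof (cases "\<forall>k. \<exists>z\<le>k. x z = 0")
      case True
      then obtain e where "e \<le> k" "run_before x e (max L l)"
        using long_runs_left[OF X(1), of k "max L l"] by auto
      then show ?thesis using right by simp
    next
      case False
      \<comment> \<open>Here \<open>x\<close> is 1 far to the left, so its first zero
        \<open>e\<close> ends runs of every length; for \<open>k < e\<close>, transferring a run of
        length \<open>e - k\<close> gives \<open>y k = 1\<close>.\<close>
      then obtain b where b: "\<And>z. z \<le> b \<Longrightarrow> x z \<noteq> 0" by auto
      obtain z where z: "x z = 0" using True by blast
      then have bz: "b < z" using b[of z] by linarith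
      define m where "m = (LEAST m. x (b + int m) = 0)"
      define e where "e = b + int m"
      have ex: "x (b + int (nat (z - b))) = 0" using z bz by simp
      have e: "x e = 0" unfolding e_def m_def using ex by (rule LeastI)
      have ones: "x i = 1" if "i < e" for i
      proof -
        have "x i \<noteq> 0"
        proof (cases "i \<le> b")
          case False
          then have "nat (i - b) < m" using that by (simp add: e_def)
          then have "x (b + int (nat (i - b))) \<noteq> 0" unfolding m_def by (rule not_less_Least)
          then show ?thesis using False by simp
        qed (rule b)
        then show ?thesis using X_binary[OF X(1), of i] by simp
      qed
      then have run: "run_before x e L" for L using e by (simp add: run_before_def)
      show ?thesis
      proof (cases "e \<le> k")
        case True
        then show ?thesis using right run by blast
      next
        case False
        have "run_before y e (e - k)"
          using long_run_transfer[of "e - k"] X eq run by blast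
        then show ?thesis using False ones by (simp add: run_before_def)
      qed
    qed
  qed
qed

end

section \<open>The dichotomy for factors\<close>

theorem theorem4p1:
  fixes q :: "nat \<Rightarrow> nat" and a :: "nat \<Rightarrow> nat \<Rightarrow> nat"
    and X Y :: "(int \<Rightarrow> nat) set"
  assumes "\<And>n. q n > 1"
    and "X = rank_one_subshift q a"
    and "unbounded_spacer q a"
    and "subshift Y"
    and "topological_factor X shift Y shift"
  shows "is_singleton Y \<or> topologically_isomorphic X shift Y shift"
proof -
  interpret rank_one q a
    using assms by unfold_locales
  obtain \<phi> where \<phi>: "continuous_on X \<phi>" "\<phi> ` X = Y" "\<And>x. x \<in> X \<Longrightarrow> \<phi> (shift x) = shift (\<phi> x)"
    using assms(5) unfolding topological_factor_def by blast
  have comp: "compact X"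
    using compact_rank_one_subshift assms(2) by simp
  obtain r :: int where r: "0 \<le> r"
      "\<And>x y i j. \<lbrakk>x \<in> X; y \<in> X; \<And>k. \<bar>k\<bar> \<le> r \<Longrightarrow> x (i + k) = y (j + k)\<rbrakk> \<Longrightarrow> \<phi> x i = \<phi> y j"
    using sliding_block_code[OF comp \<phi>(1) _ \<phi>(3)] X_translate assms(2) by blast
  interpret rank_one_code q a \<phi> r
    by unfold_locales (use r assms(2) in \<open>blast+\<close>)
  show ?thesis
  proof (cases "\<exists>k. G k \<noteq> c")
    case True
    then interpret rank_one_nontrivial_code q a \<phi> r
      by unfold_locales
    have "\<exists>\<psi>. homeomorphism X Y \<phi> \<psi>"
      using homeomorphism_compact_nat[OF comp \<phi>(1)] code_inj assms(2) \<phi>(2) by simp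
    then show ?thesis
      using \<phi>(3) unfolding topologically_isomorphic_def by blast
  next
    case False
    \<comment> \<open>Every letter of an image occurs in \<open>G\<close>, which is constantly
      \<open>c\<close>.\<close>
    then have "\<phi> x = (\<lambda>_. c)" if "x \<in> X" for x
      using code_recurs[of x] that assms(2) by (intro ext) metis
    moreover have "X \<noteq> {}"
      using ones_then_word_in_X assms(2) by blast
    ultimately have "Y = {\<lambda>_. c}"
      using \<phi>(2) by auto
    then show ?thesis by simp
  qed
qed

end
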